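(* Let $\Delta:\tilde{\mathcal D}\to\mathbb R^{n_c}$ be a dynamic safety margin (DSM), and let $\alpha$ be a class $\mathscr K$ function such that for every $(\bm x,\bm v)\in\tilde{\mathcal C}$ there exists $(\bm u,\bm w)\in\mathcal U\times\mathbb R^l$ with $\min_{i\in\{1,\dots,n_c\}}\big[\dot\Delta_i(\bm x,\bm v,\bm u,\bm w)+\alpha(\Delta_i(\bm x,\bm v))\big]\ge0$. If $(\bm x,\bm v)\in\tilde{\mathcal C}$ is such that $$\begin{bmatrix}\dfrac{\partial\Delta}{\partial\bm x}(\bm x,\bm v)\,g(\bm x) & \dfrac{\partial\Delta}{\partial\bm v}(\bm x,\bm v)\end{bmatrix}=0,$$ then $\tilde{\mathcal K}_\alpha(\bm x,\bm v)=\mathcal U\times\mathbb R^l$.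
   Context: Class $\mathscr K$: continuous strictly increasing $\alpha:[0,\infty)\to[0,\infty)$ with $\alpha(0)=0$. System: $\dot{\bm x}=f(\bm x)+g(\bm x)\bm u$, with $f:\mathbb R^n\to\mathbb R^n$ and $g:\mathbb R^n\to\mathbb R^{n\times m}$ locally Lipschitz, subject to $\bm x\in\mathcal X$, $\bm u\in\mathcal U$, where $\mathcal X\subset\mathbb R^n$ and $\mathcal U\subset\mathbb R^m$ are closed. Equilibria: there is a simply connected manifold of stabilizable equilibria parameterized by continuous $\bar x:\mathbb R^l\to\mathbb R^n$, $\bar u:\mathbb R^l\to\mathbb R^m$ with $f(\bar x(\bm v))+g(\bar x(\bm v))\bar u(\bm v)=0$ for all $\bm v\in\mathbb R^l$. The set of steady-state admissible references $\mathcal V=\{\bm v\in\mathbb R^l\mid \bar x(\bm v)\in\mathcal X,\ \bar u(\bm v)\in\mathcal U\}$ is assumed nonempty. Prestabilizing controller: $\pi:\mathbb R^n\times\mathbb R^l\to\mathbb R^m$ is jointly continuous and locally Lipschitz in its first argument, $\pi(\bar x(\bm v),\bm v)=\bar u(\bm v)$, and for each fixed $\bm v$ the point $\bar x(\bm v)$ is an asymptotically stable equilibrium of $\dot{\bm x}=f_\pi(\bm x,\bm v):=f(\bm x)+g(\bm x)\pi(\bm x,\bm v)$. For each $\bm v$, $\mathcal D_{\bm v}\subset\mathbb R^n$ is an open set containing $\bar x(\bm v)$ such that solutions of $\dot{\bm x}=f_\pi(\bm x,\bm v)$ starting in $\mathcal D_{\bm v}$ converge to $\bar x(\bm v)$.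 The set $\tilde{\mathcal D}=\{(\bm x,\bm v)\in\mathbb R^n\times\mathbb R^l\mid \bm x\in\mathcal D_{\bm v}\}$ is assumed open in $\mathbb R^n\times\mathbb R^l$. Constraint sets: $\mathcal X_{\bm v}=\{\bm x\in\mathcal X\mid \pi(\bm x,\bm v)\in\mathcal U\}$ and $\tilde{\mathcal X}=\{(\bm x,\bm v)\in\mathbb R^n\times\mathbb R^l\mid \bm x\in\mathcal X_{\bm v},\ \bm v\in\mathcal V\}$. DSM: a continuously differentiable $\Delta:\tilde{\mathcal D}\to\mathbb R^{n_c}$ with components $\Delta_i$ is a dynamic safety margin if, with $\tilde{\mathcal C}=\{(\bm x,\bm v)\in\tilde{\mathcal D}\mid \Delta(\bm x,\bm v)\ge 0\}$ (componentwise inequality): (i) $\tilde{\mathcal C}\subset\tilde{\mathcal X}$; (ii) $\tilde{\mathcal C}$ is compact in $\mathbb R^n\times\mathbb R^l$; (iii) for every $i\in\{1,\dots,n_c\}$ and $(\bm x,\bm v)\in\tilde{\mathcal D}$, $\Delta_i(\bm x,\bm v)=0$ implies $\frac{\partial\Delta_i}{\partial\bm x}(\bm x,\bm v)f_\pi(\bm x,\bm v)\ge 0$. Notation: $\dot\Delta_i(\bm x,\bm v,\bm u,\bm w)=\frac{\partial\Delta_i}{\partial\bm x}(\bm x,\bm v)(f(\bm x)+g(\bm x)\bm u)+\frac{\partial\Delta_i}{\partial\bm v}(\bm x,\bm v)\bm w$, and $\tilde{\mathcal K}_\alpha(\bm x,\bm v)$ is the set of $(\bm u,\bm w)\in\mathcal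 U\times\mathbb R^l$ with $\min_{i\in\{1,\dots,n_c\}}\big[\dot\Delta_i(\bm x,\bm v,\bm u,\bm w)+\alpha(\Delta_i(\bm x,\bm v))\big]\ge 0$. *)

theory Defs
  imports "HOL-Analysis.Analysis"
begin

definition class_K :: "(real \<Rightarrow> real) \<Rightarrow> bool" where
  "class_K \<alpha> \<longleftrightarrow> continuous_on {0..} \<alpha> \<and> strict_mono_on {0..} \<alpha> \<and> \<alpha> 0 = 0"

definition locally_lipschitz :: "('a::metric_space \<Rightarrow> 'b::metric_space) \<Rightarrow> bool" where
  "locally_lipschitz h \<longleftrightarrow> (\<forall>x. \<exists>r>0. \<exists>L. L-lipschitz_on (ball x r) h)"

definition continuously_differentiable_on ::
    "('a::real_normed_vector \<Rightarrow> 'b::real_normed_vector) \<Rightarrow> 'a set \<Rightarrow> bool" where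
  "continuously_differentiable_on h S \<longleftrightarrow>
     (\<exists>h'. (\<forall>z\<in>S. (h has_derivative blinfun_apply (h' z)) (at z)) \<and> continuous_on S h')"

(* The Hausdorff property and second countability are automatic for subsets of Euclidean space,
   so only the locally Euclidean condition is stated. The model space of dimension k is a
   k-dimensional linear subspace, which keeps k a number rather than a type. *)
definition topological_manifold :: "'a::euclidean_space set \<Rightarrow> bool" where
  "topological_manifold M \<longleftrightarrow>
     (\<exists>k. \<forall>p\<in>M. \<exists>N (T::'a set) W.
        openin (top_of_set M) N \<and> p \<in> N \<and>
        subspace T \<and> dim T = k \<and> openin (top_of_set T) W \<and> N homeomorphic W)"

definition ode_solution :: "('a::real_normed_vector \<Rightarrow> 'a) \<Rightarrow> real set \<Rightarrow> (real \<Rightarrow> 'a) \<Rightarrow> bool" where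
  "ode_solution F J \<phi> \<longleftrightarrow> (\<forall>t\<in>J. (\<phi> has_vector_derivative F (\<phi> t)) (at t within J))"

definition ode_converges :: "('a::real_normed_vector \<Rightarrow> 'a) \<Rightarrow> 'a \<Rightarrow> 'a \<Rightarrow> bool" where
  "ode_converges F xe x0 \<longleftrightarrow>
     (\<exists>\<phi>. ode_solution F {0..} \<phi> \<and> \<phi> 0 = x0) \<and>
     (\<forall>\<phi>. ode_solution F {0..} \<phi> \<and> \<phi> 0 = x0 \<longrightarrow> (\<phi> \<longlongrightarrow> xe) at_top)"

(* Lyapunov stability is required of all solutions, including those on finite intervals, so that
   it does not silently ignore solutions that are not known to extend to all times. *)
definition asymptotically_stable :: "('a::real_normed_vector \<Rightarrow> 'a) \<Rightarrow> 'a \<Rightarrow> bool" where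
  "asymptotically_stable F xe \<longleftrightarrow>
     F xe = 0 \<and>
     (\<forall>\<epsilon>>0. \<exists>\<delta>>0. \<forall>T \<phi>. ode_solution F {0..<T} \<phi> \<and> dist (\<phi> 0) xe < \<delta> \<longrightarrow>
        (\<forall>t\<in>{0..<T}. dist (\<phi> t) xe < \<epsilon>)) \<and>
     (\<exists>\<delta>>0. \<forall>x0\<in>ball xe \<delta>. ode_converges F xe x0)"

definition stabilizable ::
    "(real^'n \<Rightarrow> real^'n) \<Rightarrow> (real^'n \<Rightarrow> real^'m^'n) \<Rightarrow> real^'n \<Rightarrow> real^'m \<Rightarrow> bool" where
  "stabilizable f g xe ue \<longleftrightarrow>
     (\<exists>\<kappa>. locally_lipschitz \<kappa> \<and> \<kappa> xe = ue \<and> asymptotically_stable (\<lambda>x. f x + g x *v \<kappa> x) xe)"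

definition closed_loop ::
    "(real^'n \<Rightarrow> real^'n) \<Rightarrow> (real^'n \<Rightarrow> real^'m^'n) \<Rightarrow> ((real^'n) \<times> (real^'l) \<Rightarrow> real^'m) \<Rightarrow>
     real^'n \<Rightarrow> real^'l \<Rightarrow> real^'n" where
  "closed_loop f g \<pi> x v = f x + g x *v \<pi> (x, v)"

definition admissible_references ::
    "(real^'n) set \<Rightarrow> (real^'m) set \<Rightarrow> (real^'l \<Rightarrow> real^'n) \<Rightarrow> (real^'l \<Rightarrow> real^'m) \<Rightarrow> (real^'l) set" where
  "admissible_references X U xbar ubar = {v. xbar v \<in> X \<and> ubar v \<in> U}"

definition state_constraints ::
    "(real^'n) set \<Rightarrow> (real^'m) set \<Rightarrow> ((real^'n) \<times> (real^'l) \<Rightarrow> real^'m) \<Rightarrow> real^'l \<Rightarrow> (real^'n) set" where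
  "state_constraints X U \<pi> v = {x \<in> X. \<pi> (x, v) \<in> U}"

definition constraint_set ::
    "(real^'n) set \<Rightarrow> (real^'m) set \<Rightarrow> (real^'l \<Rightarrow> real^'n) \<Rightarrow> (real^'l \<Rightarrow> real^'m) \<Rightarrow>
     ((real^'n) \<times> (real^'l) \<Rightarrow> real^'m) \<Rightarrow> ((real^'n) \<times> (real^'l)) set" where
  "constraint_set X U xbar ubar \<pi> =
     {(x, v). x \<in> state_constraints X U \<pi> v \<and> v \<in> admissible_references X U xbar ubar}"

definition total_domain :: "(real^'l \<Rightarrow> (real^'n) set) \<Rightarrow> ((real^'n) \<times> (real^'l)) set" where
  "total_domain D = {(x, v). x \<in> D v}"

locale prestabilized_system =
  fixes f :: "real^'n \<Rightarrow> real^'n"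
    and g :: "real^'n \<Rightarrow> real^'m^'n"
    and X :: "(real^'n) set"
    and U :: "(real^'m) set"
    and xbar :: "real^'l \<Rightarrow> real^'n"
    and ubar :: "real^'l \<Rightarrow> real^'m"
    and \<pi> :: "(real^'n) \<times> (real^'l) \<Rightarrow> real^'m"
    and D :: "real^'l \<Rightarrow> (real^'n) set"
  assumes f_lipschitz: "locally_lipschitz f"
    and g_lipschitz: "locally_lipschitz g"
    and closed_X: "closed X"
    and closed_U: "closed U"
    and continuous_xbar: "continuous_on UNIV xbar"
    and continuous_ubar: "continuous_on UNIV ubar"
    and equilibrium: "\<And>v. f (xbar v) + g (xbar v) *v ubar v = 0"
    and stabilizable_equilibria: "\<And>v. stabilizable f g (xbar v) (ubar v)"
    and equilibrium_manifold: "topological_manifold (range (\<lambda>v. (xbar v, ubar v)))"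
    and simply_connected_equilibria: "simply_connected (range (\<lambda>v. (xbar v, ubar v)))"
    and references_nonempty: "admissible_references X U xbar ubar \<noteq> {}"
    and continuous_\<pi>: "continuous_on UNIV \<pi>"
    and \<pi>_lipschitz: "\<And>v. locally_lipschitz (\<lambda>x. \<pi> (x, v))"
    and \<pi>_equilibrium: "\<And>v. \<pi> (xbar v, v) = ubar v"
    and \<pi>_stabilizes: "\<And>v. asymptotically_stable (\<lambda>x. closed_loop f g \<pi> x v) (xbar v)"
    and open_D: "\<And>v. open (D v)"
    and xbar_in_D: "\<And>v. xbar v \<in> D v"
    and D_attracted: "\<And>v x0. x0 \<in> D v \<Longrightarrow> ode_converges (\<lambda>x. closed_loop f g \<pi> x v) (xbar v) x0"
    and open_total_domain: "open (total_domain D)"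

(* Margins are total functions on the product space, but are only ever used at points of the
   open set total_domain D, where the Jacobians depend on the values inside that set alone. *)
definition margin_jacobian_x ::
    "((real^'n) \<times> (real^'l) \<Rightarrow> real^'c) \<Rightarrow> real^'n \<Rightarrow> real^'l \<Rightarrow> real^'n^'c" where
  "margin_jacobian_x \<Delta> x v = jacobian (\<lambda>y. \<Delta> (y, v)) (at x)"

definition margin_jacobian_v ::
    "((real^'n) \<times> (real^'l) \<Rightarrow> real^'c) \<Rightarrow> real^'n \<Rightarrow> real^'l \<Rightarrow> real^'l^'c" where
  "margin_jacobian_v \<Delta> x v = jacobian (\<lambda>w. \<Delta> (x, w)) (at v)"

definition block_row :: "real^'p^'c \<Rightarrow> real^'q^'c \<Rightarrow> real^('p + 'q)^'c" where
  "block_row A B = (\<chi> i j. case j of Inl a \<Rightarrow> A $ i $ a | Inr b \<Rightarrow> B $ i $ b)"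

definition safe_set ::
    "(real^'l \<Rightarrow> (real^'n) set) \<Rightarrow> ((real^'n) \<times> (real^'l) \<Rightarrow> real^'c) \<Rightarrow> ((real^'n) \<times> (real^'l)) set" where
  "safe_set D \<Delta> = {z \<in> total_domain D. \<forall>i. 0 \<le> \<Delta> z $ i}"

definition dynamic_safety_margin ::
    "(real^'n \<Rightarrow> real^'n) \<Rightarrow> (real^'n \<Rightarrow> real^'m^'n) \<Rightarrow> (real^'n) set \<Rightarrow> (real^'m) set \<Rightarrow>
     (real^'l \<Rightarrow> real^'n) \<Rightarrow> (real^'l \<Rightarrow> real^'m) \<Rightarrow> ((real^'n) \<times> (real^'l) \<Rightarrow> real^'m) \<Rightarrow>
     (real^'l \<Rightarrow> (real^'n) set) \<Rightarrow> ((real^'n) \<times> (real^'l) \<Rightarrow> real^'c) \<Rightarrow> bool" where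
  "dynamic_safety_margin f g X U xbar ubar \<pi> D \<Delta> \<longleftrightarrow>
     continuously_differentiable_on \<Delta> (total_domain D) \<and>
     safe_set D \<Delta> \<subseteq> constraint_set X U xbar ubar \<pi> \<and>
     compact (safe_set D \<Delta>) \<and>
     (\<forall>i x v. (x, v) \<in> total_domain D \<longrightarrow> \<Delta> (x, v) $ i = 0 \<longrightarrow>
        0 \<le> (margin_jacobian_x \<Delta> x v *v closed_loop f g \<pi> x v) $ i)"

definition margin_rate ::
    "(real^'n \<Rightarrow> real^'n) \<Rightarrow> (real^'n \<Rightarrow> real^'m^'n) \<Rightarrow> ((real^'n) \<times> (real^'l) \<Rightarrow> real^'c) \<Rightarrow>
     real^'n \<Rightarrow> real^'l \<Rightarrow> real^'m \<Rightarrow> real^'l \<Rightarrow> real^'c" where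
  "margin_rate f g \<Delta> x v u w =
     margin_jacobian_x \<Delta> x v *v (f x + g x *v u) + margin_jacobian_v \<Delta> x v *v w"

definition safe_controls ::
    "(real^'n \<Rightarrow> real^'n) \<Rightarrow> (real^'n \<Rightarrow> real^'m^'n) \<Rightarrow> (real^'m) set \<Rightarrow>
     ((real^'n) \<times> (real^'l) \<Rightarrow> real^'c) \<Rightarrow> (real \<Rightarrow> real) \<Rightarrow>
     real^'n \<Rightarrow> real^'l \<Rightarrow> ((real^'m) \<times> (real^'l)) set" where
  "safe_controls f g U \<Delta> \<alpha> x v =
     {(u, w) \<in> U \<times> UNIV. 0 \<le> (MIN i. margin_rate f g \<Delta> x v u w $ i + \<alpha> (\<Delta> (x, v) $ i))}"

end

theory Submission
  imports Defs
begin

text \<open>The rate of the margin is affine in (u, w), and its linear part is the block matrix.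
  Where that matrix vanishes, the rate is the drift term alone
  (\<open>margin_rate_eq_drift\<close>), so the sign of the minimum is the same for every input
  pair. Feasibility of one pair, which the assumption on \<alpha> provides, is then feasibility of
  all.\<close>

lemma block_row_eq_0_iff: "block_row A B = 0 \<longleftrightarrow> A = 0 \<and> B = 0"
  by (auto simp: block_row_def vec_eq_iff split: sum.split)

text \<open>By associativity u enters only through the first block and w only through the second;
  both blocks are zero.\<close>

lemma margin_rate_eq_drift:
  assumes "block_row (margin_jacobian_x \<Delta> x v ** g x) (margin_jacobian_v \<Delta> x v) = 0"
  shows "margin_rate f g \<Delta> x v u w = margin_jacobian_x \<Delta> x v *v f x"
  using assms
  by (simp add: block_row_eq_0_iff margin_rate_def matrix_vector_right_distrib
      matrix_vector_mul_assoc)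

theorem corollary2:
  fixes f :: "real^'n \<Rightarrow> real^'n"
    and g :: "real^'n \<Rightarrow> real^'m^'n"
    and X :: "(real^'n) set"
    and U :: "(real^'m) set"
    and xbar :: "real^'l \<Rightarrow> real^'n"
    and ubar :: "real^'l \<Rightarrow> real^'m"
    and \<pi> :: "(real^'n) \<times> (real^'l) \<Rightarrow> real^'m"
    and D :: "real^'l \<Rightarrow> (real^'n) set"
    and \<Delta> :: "(real^'n) \<times> (real^'l) \<Rightarrow> real^'c"
    and \<alpha> :: "real \<Rightarrow> real"
    and x :: "real^'n" and v :: "real^'l"
  assumes "prestabilized_system f g X U xbar ubar \<pi> D"
    and "dynamic_safety_margin f g X U xbar ubar \<pi> D \<Delta>"
    and "class_K \<alpha>"
    and "\<forall>(x, v) \<in> safe_set D \<Delta>. \<exists>u\<in>U. \<exists>w::real^'l.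
           0 \<le> (MIN i. margin_rate f g \<Delta> x v u w $ i + \<alpha> (\<Delta> (x, v) $ i))"
    and "(x, v) \<in> safe_set D \<Delta>"
    and "block_row (margin_jacobian_x \<Delta> x v ** g x) (margin_jacobian_v \<Delta> x v) = 0"
  shows "safe_controls f g U \<Delta> \<alpha> x v = U \<times> (UNIV :: (real^'l) set)"
proof -
  obtain u\<^sub>0 w\<^sub>0 where
    "0 \<le> (MIN i. margin_rate f g \<Delta> x v u\<^sub>0 w\<^sub>0 $ i + \<alpha> (\<Delta> (x, v) $ i))"
    using assms(4,5) by blast
  then show ?thesis
    \<comment> \<open>Fixing \<open>g\<close> avoids an ambiguous higher-order match with
      \<open>g x\<close>. The inputs stay schematic, so both the fact for the witness pair and the
      goal for an arbitrary pair rewrite to the same minimum.\<close>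
    by (auto simp: safe_controls_def margin_rate_eq_drift[where g = g, OF assms(6)])
qed

end
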